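(* Let $y=\theta^*+\epsilon\in\mathbb{R}^n$, where the coordinates of $\epsilon$ are i.i.d. mean $0$ subgaussian with subgaussian norm $\sigma$. Let $\{\hat\theta^{(\lambda)}:\lambda\in\mathbb{R}_+\}$ be a given family of estimators of $\theta^*$, and let $\hat\theta_{CV}$ be the $K$-fold cross validated estimator built from it by the framework described in the context (with folds $I_1,\dots,I_K$, completion estimators $\hat\theta^{(\lambda,I_j^c)}$, finite candidate sets $\Lambda_j$, and candidate set $\Lambda$). Then for all $x\ge 0$, with probability not less than $1-2K\exp(-x^2/2)$, $$\|\hat\theta_{CV}-\theta^*\|\le \min_{\lambda\in\Lambda}\|\hat\theta^{(\lambda)}-\theta^*\|+4\sum_{j\in[K]}\min_{\lambda_j\in\Lambda_j}\big\|\hat\theta^{(\lambda_j,I_j^c)}_{I_j}-\theta^*_{I_j}\big\|+8\sqrt2\,\sigma\sum_{j\in[K]}\sqrt{\log|\Lambda_j|}+8\sigma Kx .$$ The probability is with respect to the joint law of $\epsilon$ and the (possibly random) folds.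
   Context: A mean-zero random variable $Z$ is subgaussian with norm $\sigma$ if $\mathbb{E}e^{tZ}\le e^{\sigma^2t^2/2}$ for all $t\in\mathbb{R}$. $[m]=\{1,\dots,m\}$; $\|\cdot\|$ is the Euclidean norm; $v_S$ is the restriction of $v$ to coordinates in $S$. Cross validation framework. (1) Choose a number of folds $K\ge 2$. (2) Partition $[n]$ into $K$ disjoint folds $I_1,\dots,I_K$, deterministically or using randomization independent of $\epsilon$; $I_j^c=[n]\setminus I_j$. (3) For each $j\in[K]$ and $\lambda>0$, choose a "completion estimator" $\hat\theta^{(\lambda,I_j^c)}\in\mathbb{R}^n$ which depends on the data $y$ only through $y_{I_j^c}$. (4) For each $j\in[K]$ choose a nonempty finite set $\Lambda_j$ of candidate tuning values, either deterministic or a function of $y_{I_j^c}$. (5) Let $\hat\lambda_j\in\operatorname{argmin}_{\lambda\in\Lambda_j}\|y_{I_j}-\hat\theta^{(\lambda,I_j^c)}_{I_j}\|^2$ and define the intermediate estimator $\tilde\theta\in\mathbb{R}^n$ by $\tilde\theta_{I_j}=\hat\theta^{(\hat\lambda_j,I_j^c)}_{I_j}$, $j\in[K]$. (6) Let $\Lambda$ be a deterministic set of candidate tuning values (such that the minima over $\Lambda$ are attained, e.g. $\Lambda$ finite), $\hat\lambda\in\operatorname{argmin}_{\lambda\in\Lambda}\|\hat\theta^{(\lambda)}-\tilde\theta\|^2$, and $\hat\theta_{CV}=\hat\theta^{(\hat\lambda)}$. All estimators are measurable functions of the data. *)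

theory Defs
  imports "HOL-Probability.Probability"
begin

definition subgaussian :: "'w measure \<Rightarrow> ('w \<Rightarrow> real) \<Rightarrow> real \<Rightarrow> bool" where
  "subgaussian M Z \<sigma> \<longleftrightarrow>
     0 \<le> \<sigma> \<and> integrable M Z \<and> (LINT \<omega>|M. Z \<omega>) = 0 \<and>
     (\<forall>t::real. integrable M (\<lambda>\<omega>. exp (t * Z \<omega>)) \<and>
        (LINT \<omega>|M. exp (t * Z \<omega>)) \<le> exp (\<sigma>\<^sup>2 * t\<^sup>2 / 2))"

text \<open>The restriction of a vector to the coordinates in \<open>S\<close>, padded by zeros off \<open>S\<close>: the padding
  leaves norms unchanged, and two vectors have the same restriction iff they agree on \<open>S\<close>.\<close>

definition restr :: "'n set \<Rightarrow> real ^ 'n \<Rightarrow> real ^ 'n" where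
  "restr S v = (\<chi> i. if i \<in> S then v $ i else 0)"

definition depends_only_on :: "'n set \<Rightarrow> (real ^ 'n \<Rightarrow> 'b) \<Rightarrow> bool" where
  "depends_only_on S f \<longleftrightarrow> (\<forall>y y'. restr S y = restr S y' \<longrightarrow> f y = f y')"

text \<open>Folds are indexed by a finite type \<open>'k\<close>, so the number of folds is \<open>CARD('k)\<close>. Folds may be
  empty, as can happen when each index is assigned to a fold at random.\<close>

definition fold_partition :: "('k \<Rightarrow> 'n set) \<Rightarrow> bool" where
  "fold_partition I \<longleftrightarrow> disjoint_family I \<and> (\<Union>j. I j) = UNIV"

text \<open>The completion estimator of fold \<open>j\<close> is chosen after the partition, hence is a function of
  the partition \<open>I\<close>, the fold \<open>j\<close>, the tuning value and the data.\<close>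

definition completion_estimators ::
  "(('k \<Rightarrow> 'n::finite set) \<Rightarrow> 'k \<Rightarrow> real \<Rightarrow> real ^ 'n \<Rightarrow> real ^ 'n) \<Rightarrow> bool" where
  "completion_estimators \<theta>c \<longleftrightarrow>
     (\<forall>I j l. fold_partition I \<longrightarrow> 0 < l \<longrightarrow>
        \<theta>c I j l \<in> borel_measurable borel \<and> depends_only_on (- I j) (\<theta>c I j l))"

text \<open>Each \<open>\<Lambda>f I j\<close> is a finite random set (a function of the data) that is measurable in the sense
  of Effros, and the completion estimator is jointly measurable in the tuning value and the data
  along its graph, so that plugging in a measurable data-driven candidate gives a measurable
  estimator. If \<open>\<Lambda>f I j\<close> is deterministic, the last two conditions add nothing: the first is
  trivial and the second follows from measurability for each fixed tuning value.\<close>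

definition candidate_sets ::
  "(('k \<Rightarrow> 'n::finite set) \<Rightarrow> 'k \<Rightarrow> real \<Rightarrow> real ^ 'n \<Rightarrow> real ^ 'n)
    \<Rightarrow> (('k \<Rightarrow> 'n set) \<Rightarrow> 'k \<Rightarrow> real ^ 'n \<Rightarrow> real set) \<Rightarrow> bool" where
  "candidate_sets \<theta>c \<Lambda>f \<longleftrightarrow>
     (\<forall>I j. fold_partition I \<longrightarrow>
        depends_only_on (- I j) (\<Lambda>f I j) \<and>
        (\<forall>y. finite (\<Lambda>f I j y) \<and> \<Lambda>f I j y \<noteq> {} \<and> \<Lambda>f I j y \<subseteq> {0<..}) \<and>
        (\<forall>B. open B \<longrightarrow> {y. \<Lambda>f I j y \<inter> B \<noteq> {}} \<in> sets borel) \<and>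
        (\<lambda>(l, y). \<theta>c I j l y) \<in>
          borel_measurable (restrict_space borel {(l, y). l \<in> \<Lambda>f I j y}))"

definition fold_selection ::
  "(('k \<Rightarrow> 'n::finite set) \<Rightarrow> 'k \<Rightarrow> real \<Rightarrow> real ^ 'n \<Rightarrow> real ^ 'n)
    \<Rightarrow> (('k \<Rightarrow> 'n set) \<Rightarrow> 'k \<Rightarrow> real ^ 'n \<Rightarrow> real set)
    \<Rightarrow> (('k \<Rightarrow> 'n set) \<Rightarrow> 'k \<Rightarrow> real ^ 'n \<Rightarrow> real) \<Rightarrow> bool" where
  "fold_selection \<theta>c \<Lambda>f lf \<longleftrightarrow>
     (\<forall>I j y. fold_partition I \<longrightarrow>
        is_arg_min (\<lambda>l. (norm (restr (I j) y - restr (I j) (\<theta>c I j l y)))\<^sup>2)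
          (\<lambda>l. l \<in> \<Lambda>f I j y) (lf I j y))"

definition fold_of :: "('k \<Rightarrow> 'n set) \<Rightarrow> 'n \<Rightarrow> 'k" where
  "fold_of I i = (THE j. i \<in> I j)"

definition intermediate_estimator ::
  "(('k \<Rightarrow> 'n::finite set) \<Rightarrow> 'k \<Rightarrow> real \<Rightarrow> real ^ 'n \<Rightarrow> real ^ 'n)
    \<Rightarrow> (('k \<Rightarrow> 'n set) \<Rightarrow> 'k \<Rightarrow> real ^ 'n \<Rightarrow> real)
    \<Rightarrow> ('k \<Rightarrow> 'n set) \<Rightarrow> real ^ 'n \<Rightarrow> real ^ 'n" where
  "intermediate_estimator \<theta>c lf I y =
     (\<chi> i. \<theta>c I (fold_of I i) (lf I (fold_of I i) y) y $ i)"

definition final_selection ::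
  "(real \<Rightarrow> real ^ 'n::finite \<Rightarrow> real ^ 'n) \<Rightarrow> real set
    \<Rightarrow> (('k \<Rightarrow> 'n set) \<Rightarrow> real ^ 'n \<Rightarrow> real ^ 'n)
    \<Rightarrow> (('k \<Rightarrow> 'n set) \<Rightarrow> real ^ 'n \<Rightarrow> real) \<Rightarrow> bool" where
  "final_selection \<theta>h \<Lambda> \<theta>t lh \<longleftrightarrow>
     (\<forall>I y. fold_partition I \<longrightarrow>
        is_arg_min (\<lambda>l. (norm (\<theta>h l y - \<theta>t I y))\<^sup>2) (\<lambda>l. l \<in> \<Lambda>) (lh I y))"

definition cv_estimator ::
  "(real \<Rightarrow> real ^ 'n::finite \<Rightarrow> real ^ 'n) \<Rightarrow> (('k \<Rightarrow> 'n set) \<Rightarrow> real ^ 'n \<Rightarrow> real)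
    \<Rightarrow> ('k \<Rightarrow> 'n set) \<Rightarrow> real ^ 'n \<Rightarrow> real ^ 'n" where
  "cv_estimator \<theta>h lh I y = \<theta>h (lh I y) y"

text \<open>The risk bound is stated as holding on a measurable event of the given probability: for an
  uncountable \<open>\<Lambda>\<close> the minimum over \<open>\<Lambda>\<close> of the errors, hence the set where the bound holds, need
  not be measurable. When that set is measurable, this is the usual lower bound on its probability.\<close>

end

theory Submission imports Defs begin

text \<open>Two triangle inequalities bound the error of the cross validated estimator by the error of any
  candidate plus twice the error of the intermediate estimator, and the latter is at most the sum
  of its restrictions to the folds. On a fold, let \<open>a\<close> and \<open>b\<close> be the errors of the selected and of
  the best candidate, and \<open>e\<close> the noise. Minimality of the selected residual says
  \<open>\<parallel>a\<parallel>\<^sup>2 \<le> \<parallel>b\<parallel>\<^sup>2 + 2 (e \<bullet> (a - b))\<close>. Given the noise off the fold, the \<open>N\<close> candidates are fixed, so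
  Chernoff bounds over all \<open>N\<^sup>2\<close> pairs show that \<open>e \<bullet> (a - b) \<le> \<sigma> (2 sqrt (ln N) + x) \<parallel>a - b\<parallel>\<close>
  fails with probability at most \<open>exp (- (x\<^sup>2 / 2))\<close>. Using all pairs avoids choosing \<open>b\<close>
  measurably. Random folds are treated by conditioning on the finitely many partitions.\<close>

section \<open>Restriction to coordinates and partitions into folds\<close>

lemma restr_nth [simp]: "restr S v $ i = (if i \<in> S then v $ i else 0)"
  by (simp add: restr_def)

lemma restr_add: "restr S (v + w) = restr S v + restr S w"
  and restr_diff: "restr S (v - w) = restr S v - restr S w"
  by (simp_all add: vec_eq_iff)

lemma restr_restr: "restr S (restr T v) = restr (S \<inter> T) v"
  by (auto simp: vec_eq_iff)

lemma inner_restr_left: "restr S v \<bullet> w = v \<bullet> restr S w"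
  unfolding inner_vec_def by (intro sum.cong) auto

lemma restr_measurable [measurable]:
  "restr S \<in> borel_measurable (borel :: (real ^ 'n::finite) measure)"
proof -
  have "continuous_on UNIV (restr S :: real ^ 'n \<Rightarrow> real ^ 'n)"
    unfolding restr_def
  proof (rule continuous_on_vec_lambda)
    fix i
    show "continuous_on UNIV (\<lambda>v :: real ^ 'n. if i \<in> S then v $ i else 0)"
      by (cases "i \<in> S") (auto intro!: continuous_intros)
  qed
  then show ?thesis by (rule borel_measurable_continuous_onI)
qed

text \<open>Lets the noise on a fold be replaced by zero inside anything computed from the other
  folds, which turns it into a function of the off-fold noise alone.\<close>

lemma depends_only_on_restr:
  assumes "depends_only_on T f"
  shows "f (a + restr T e) = f (a + e)"
proof -
  have "restr T (a + restr T e) = restr T (a + e)"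
    by (simp add: vec_eq_iff)
  then show ?thesis using assms unfolding depends_only_on_def by blast
qed

lemma fold_of_eq:
  assumes "fold_partition J" "i \<in> J j"
  shows "fold_of J i = j"
  unfolding fold_of_def
proof (rule the_equality)
  fix j' assume "i \<in> J j'"
  then show "j' = j"
    using assms unfolding fold_partition_def disjoint_family_on_def by blast
qed (fact assms(2))

text \<open>Each coordinate lies in exactly one fold, so \<open>v\<close> is the sum of its
  restrictions and the triangle inequality applies.\<close>

lemma norm_le_sum_folds:
  fixes J :: "'k::finite \<Rightarrow> 'n::finite set"
  assumes "fold_partition J"
  shows "norm v \<le> (\<Sum>j\<in>UNIV. norm (restr (J j) v))"
proof -
  have "v = (\<Sum>j\<in>UNIV. restr (J j) v)"
  proof (subst vec_eq_iff, intro allI)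
    fix i
    have mem: "i \<in> J j \<longleftrightarrow> j = fold_of J i" for j
      using assms fold_of_eq[OF assms] unfolding fold_partition_def by blast
    show "v $ i = (\<Sum>j\<in>UNIV. restr (J j) v) $ i"
      by (simp add: mem)
  qed
  then show ?thesis by (metis norm_sum)
qed

section \<open>Measurability of finite random sets\<close>

text \<open>A finite set of reals is enumerated by sending a rational \<open>q\<close> to the least element above \<open>q\<close>.\<close>

lemma measurable_enumeration:
  fixes L :: "'a \<Rightarrow> real set"
  assumes fin: "\<And>y. y \<in> space N \<Longrightarrow> finite (L y) \<and> L y \<noteq> {}"
    and effros: "\<And>B. open B \<Longrightarrow> {y \<in> space N. L y \<inter> B \<noteq> {}} \<in> sets N"
  obtains h :: "rat \<Rightarrow> 'a \<Rightarrow> real"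
  where "\<And>q. h q \<in> borel_measurable N"
    and "\<And>y. y \<in> space N \<Longrightarrow> L y = range (\<lambda>q. h q y)"
proof
  \<comment> \<open>The fallback \<open>Min (L y)\<close> keeps the value in \<open>L y\<close> when
    no element exceeds \<open>q\<close>.\<close>
  define h :: "rat \<Rightarrow> 'a \<Rightarrow> real" where
    "h q y = (if L y \<inter> {of_rat q<..} = {} then Min (L y) else Min (L y \<inter> {of_rat q<..}))" for q y
  show "h q \<in> borel_measurable N" for q
  proof (rule borel_measurableI_less)
    fix c
    \<comment> \<open>Both alternatives only ask whether \<open>L y\<close> meets certain open sets,
      which is what the Effros condition makes measurable.\<close>
    have "h q y < c \<longleftrightarrow> L y \<inter> {of_rat q<..<c} \<noteq> {} \<or> L y \<inter> {of_rat q<..} = {} \<and> L y \<inter> {..<c} \<noteq> {}"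
      if y: "y \<in> space N" for y
    proof (cases "L y \<inter> {of_rat q<..} = {}")
      case True
      then have "h q y = Min (L y)" by (simp add: h_def)
      moreover have "Min (L y) < c \<longleftrightarrow> (\<exists>a\<in>L y. a < c)"
        using fin[OF y] by (intro Min_less_iff) auto
      ultimately show ?thesis using True by fastforce
    next
      case False
      then have "h q y = Min (L y \<inter> {of_rat q<..})" by (simp add: h_def)
      moreover have "Min (L y \<inter> {of_rat q<..}) < c \<longleftrightarrow> (\<exists>a\<in>L y \<inter> {of_rat q<..}. a < c)"
        using fin[OF y] False by (intro Min_less_iff) auto
      ultimately show ?thesis using False by fastforce
    qed
    then have "{y \<in> space N. h q y < c} =
        {y \<in> space N. L y \<inter> {of_rat q<..<c} \<noteq> {}} \<union>
        ({y \<in> space N. L y \<inter> {..<c} \<noteq> {}} - {y \<in> space N. L y \<inter> {of_rat q<..} \<noteq> {}})"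
      by blast
    then show "{y \<in> space N. h q y < c} \<in> sets N"
      using effros by auto
  qed
  show "L y = range (\<lambda>q. h q y)" if y: "y \<in> space N" for y
  proof
    show "range (\<lambda>q. h q y) \<subseteq> L y"
    proof clarify
      fix q
      show "h q y \<in> L y"
        using fin[OF y] Min_in[of "L y"] Min_in[of "L y \<inter> {of_rat q<..}"]
        by (auto simp: h_def)
    qed
    show "L y \<subseteq> range (\<lambda>q. h q y)"
    proof
      fix l assume l: "l \<in> L y"
      \<comment> \<open>No element of \<open>L y\<close> lies strictly between \<open>p\<close> and
        \<open>l\<close>, so any rational \<open>q\<close> in that gap enumerates \<open>l\<close>.
        Inserting \<open>l - 1\<close> keeps the set nonempty when \<open>l\<close> is the least
        element.\<close>
      define p where "p = Max (insert (l - 1) (L y \<inter> {..<l}))"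
      have "p < l" using fin[OF y] by (auto simp: p_def)
      then obtain q where q: "p < of_rat q" "of_rat q < l"
        using of_rat_dense by blast
      have "Min (L y \<inter> {of_rat q<..}) = l"
      proof (rule Min_eqI)
        fix l' assume l': "l' \<in> L y \<inter> {of_rat q<..}"
        show "l \<le> l'"
        proof (rule ccontr)
          assume "\<not> l \<le> l'"
          then have "l' \<le> p" unfolding p_def using l' fin[OF y] by (intro Max_ge) auto
          then show False using l' q by auto
        qed
      qed (use l q fin[OF y] in auto)
      then have "h q y = l" using l q by (auto simp: h_def)
      then show "l \<in> range (\<lambda>q. h q y)" by blast
    qed
  qed
qed

text \<open>At least \<open>m\<close> values are taken iff the enumeration is injective on some set
  of \<open>m\<close> indices. There are countably many such sets, and injectivity on each is a
  finite measurable condition. This makes a noise threshold depending on the number of candidates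
  measurable.\<close>

lemma card_range_measurable:
  fixes h :: "'q::countable \<Rightarrow> 'a \<Rightarrow> real"
  assumes [measurable]: "\<And>q. h q \<in> borel_measurable N"
    and fin: "\<And>y. y \<in> space N \<Longrightarrow> finite (range (\<lambda>q. h q y))"
  shows "(\<lambda>y. card (range (\<lambda>q. h q y))) \<in> measurable N (count_space UNIV)"
proof -
  let ?N = "\<lambda>y. card (range (\<lambda>q. h q y))"
  let ?F = "\<lambda>m. {F :: 'q set. finite F \<and> card F = m}"
  have ge: "{y \<in> space N. m \<le> ?N y} \<in> sets N" for m
  proof -
    have "m \<le> ?N y \<longleftrightarrow> (\<exists>F\<in>?F m. inj_on (\<lambda>q. h q y) F)" if y: "y \<in> space N" for y
    proof
      assume "m \<le> ?N y"
      then obtain T where T: "T \<subseteq> range (\<lambda>q. h q y)" "card T = m" "finite T"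
        using obtain_subset_with_card_n by blast
      then obtain F where "inj_on (\<lambda>q. h q y) F" "T = (\<lambda>q. h q y) ` F"
        using subset_image_inj[of T "\<lambda>q. h q y" UNIV] by blast
      then show "\<exists>F\<in>?F m. inj_on (\<lambda>q. h q y) F"
        using T by (auto simp: card_image finite_image_iff)
    next
      assume "\<exists>F\<in>?F m. inj_on (\<lambda>q. h q y) F"
      then show "m \<le> ?N y"
        using fin[OF y] card_mono[of "range (\<lambda>q. h q y)"]
        by (metis (mono_tags, lifting) card_image image_mono mem_Collect_eq subset_UNIV)
    qed
    then have "{y \<in> space N. m \<le> ?N y} =
        (\<Union>F\<in>?F m. {y \<in> space N. inj_on (\<lambda>q. h q y) F})"
      by auto
    also have "\<dots> \<in> sets N"
    proof (rule sets.countable_UN'')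
      have "countable {F :: 'q set. finite F \<and> F \<subseteq> UNIV}"
        by (rule countable_Collect_finite_subset) auto
      then show "countable (?F m)" by (rule countable_subset[rotated]) auto
      fix F assume "F \<in> ?F m"
      then have [simp]: "finite F" by auto
      show "{y \<in> space N. inj_on (\<lambda>q. h q y) F} \<in> sets N"
        unfolding inj_on_def by measurable
    qed
    finally show ?thesis .
  qed
  show ?thesis
  proof (intro measurable_count_space_eq2_countable[THEN iffD2] conjI ballI)
    fix m
    have "?N -` {m} \<inter> space N = {y \<in> space N. m \<le> ?N y} - {y \<in> space N. Suc m \<le> ?N y}"
      by auto
    then show "?N -` {m} \<inter> space N \<in> sets N" using ge by auto
  qed simp
qed

section \<open>Tail bounds for subgaussian noise\<close>

context prob_space
begin

lemma chernoff_subgaussian: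
  assumes exp_int: "\<And>t. integrable M (\<lambda>\<omega>. exp (t * Z \<omega>))"
    and mgf: "\<And>t. expectation (\<lambda>\<omega>. exp (t * Z \<omega>)) \<le> exp (c\<^sup>2 * t\<^sup>2 / 2)"
    and [measurable]: "Z \<in> borel_measurable M"
    and "0 \<le> c" "0 \<le> s"
  shows "prob {\<omega> \<in> space M. c * s < Z \<omega>} \<le> exp (- (s\<^sup>2 / 2))"
proof (cases "c = 0")
  case True
  \<comment> \<open>The moment bounds at \<open>1\<close> and \<open>-1\<close> force \<open>Z = 0\<close> almost surely.\<close>
  let ?f = "\<lambda>\<omega>. exp (1 * Z \<omega>) + exp (-1 * Z \<omega>) - 2"
  have f_eq: "?f \<omega> = (exp (Z \<omega> / 2) - exp (- (Z \<omega> / 2)))\<^sup>2" for \<omega>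
    by (simp add: power2_diff flip: exp_add exp_of_nat_mult)
  have "expectation ?f \<le> 0"
    using mgf[of 1] mgf[of "-1"] exp_int[of 1] exp_int[of "-1"] True
    by (simp add: prob_space)
  moreover have "0 \<le> expectation ?f" unfolding f_eq by simp
  ultimately have "expectation ?f = 0" by simp
  moreover have "integrable M ?f" using exp_int[of 1] exp_int[of "-1"] by simp
  ultimately have "AE \<omega> in M. ?f \<omega> = 0"
    using integral_nonneg_eq_0_iff_AE[of M ?f] unfolding f_eq by auto
  then have "AE \<omega> in M. \<not> 0 < Z \<omega>" unfolding f_eq by (rule AE_mp) auto
  then have "prob {\<omega> \<in> space M. 0 < Z \<omega>} = 0"
    by (subst prob_eq_0) auto
  then show ?thesis using True by simp
next
  case False
  then have c: "0 < c" using assms by simp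
  let ?t = "s / c"
  have "prob {\<omega> \<in> space M. c * s < Z \<omega>} \<le> prob {\<omega> \<in> space M. exp (s\<^sup>2) \<le> exp (?t * Z \<omega>)}"
  proof (rule finite_measure_mono)
    have "s\<^sup>2 \<le> ?t * z" if "c * s < z" for z
      using mult_left_mono[of "c * s" z ?t] that c \<open>0 \<le> s\<close> by (simp add: power2_eq_square)
    then show "{\<omega> \<in> space M. c * s < Z \<omega>} \<subseteq> {\<omega> \<in> space M. exp (s\<^sup>2) \<le> exp (?t * Z \<omega>)}"
      by auto
  qed simp
  also have "\<dots> \<le> expectation (\<lambda>\<omega>. exp (?t * Z \<omega>)) / exp (s\<^sup>2)"
    by (rule integral_Markov_inequality_measure[where A="{}"]) (use exp_int[of ?t] in auto)
  also have "\<dots> \<le> exp (c\<^sup>2 * ?t\<^sup>2 / 2) / exp (s\<^sup>2)"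
    by (intro divide_right_mono mgf) auto
  also have "\<dots> = exp (- (s\<^sup>2 / 2))"
    using c by (simp add: power_divide flip: exp_diff)
  finally show ?thesis .
qed

text \<open>By independence the moment generating function of the inner product factors over the
  coordinates, and the exponents add up to those of a subgaussian variable with norm
  \<open>\<sigma> * norm b\<close>.\<close>

lemma subgaussian_inner_tail:
  fixes \<epsilon> :: "'a \<Rightarrow> real ^ 'n::finite"
  assumes indep: "indep_vars (\<lambda>_. borel) (\<lambda>i \<omega>. \<epsilon> \<omega> $ i) UNIV"
    and sub: "\<And>i. subgaussian M (\<lambda>\<omega>. \<epsilon> \<omega> $ i) \<sigma>"
    and "0 \<le> s"
  shows "prob {\<omega> \<in> space M. \<sigma> * s * norm b < \<epsilon> \<omega> \<bullet> b} \<le> exp (- (s\<^sup>2 / 2))"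
proof -
  have [measurable]: "(\<lambda>\<omega>. \<epsilon> \<omega> $ i) \<in> borel_measurable M" for i
    using indep unfolding indep_vars_def by auto
  have exp_prod: "exp (t * (\<epsilon> \<omega> \<bullet> b)) = (\<Prod>i\<in>UNIV. exp ((t * b $ i) * \<epsilon> \<omega> $ i))" for t \<omega>
    by (simp add: inner_vec_def sum_distrib_left mult_ac flip: exp_sum)
  have ind: "indep_vars (\<lambda>_. borel) (\<lambda>i \<omega>. exp ((t * b $ i) * \<epsilon> \<omega> $ i)) UNIV" for t
    by (rule indep_vars_compose2[OF indep]) simp
  have int: "integrable M (\<lambda>\<omega>. exp (t * \<epsilon> \<omega> $ i))" for t i
    using sub[of i] unfolding subgaussian_def by blast
  have "prob {\<omega> \<in> space M. (\<sigma> * norm b) * s < \<epsilon> \<omega> \<bullet> b} \<le> exp (- (s\<^sup>2 / 2))"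
  proof (rule chernoff_subgaussian)
    fix t
    show "integrable M (\<lambda>\<omega>. exp (t * (\<epsilon> \<omega> \<bullet> b)))"
      unfolding exp_prod by (rule indep_vars_integrable[OF _ ind]) (use int in auto)
    have "expectation (\<lambda>\<omega>. exp (t * (\<epsilon> \<omega> \<bullet> b))) =
        (\<Prod>i\<in>UNIV. expectation (\<lambda>\<omega>. exp ((t * b $ i) * \<epsilon> \<omega> $ i)))"
      unfolding exp_prod by (rule indep_vars_lebesgue_integral[OF _ ind]) (use int in auto)
    also have "\<dots> \<le> (\<Prod>i\<in>UNIV. exp (\<sigma>\<^sup>2 * (t * b $ i)\<^sup>2 / 2))"
      using sub by (intro prod_mono) (auto simp: subgaussian_def)
    also have "\<dots> = exp ((\<sigma> * norm b)\<^sup>2 * t\<^sup>2 / 2)"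
      unfolding power_mult_distrib power2_norm_eq_inner
      by (simp add: inner_vec_def power2_eq_square sum_distrib_left sum_distrib_right
          sum_divide_distrib mult_ac flip: exp_sum)
    finally show "expectation (\<lambda>\<omega>. exp (t * (\<epsilon> \<omega> \<bullet> b))) \<le> exp ((\<sigma> * norm b)\<^sup>2 * t\<^sup>2 / 2)" .
  next
    show "(\<lambda>\<omega>. \<epsilon> \<omega> \<bullet> b) \<in> borel_measurable M" unfolding inner_vec_def by measurable
    show "0 \<le> \<sigma> * norm b" using sub unfolding subgaussian_def by auto
  qed fact
  then show ?thesis by (simp add: mult_ac)
qed

text \<open>A union bound over all ordered pairs costs the factor \<open>(card L)\<^sup>2\<close>,
  which the term \<open>2 * sqrt (ln (card L))\<close> in the threshold pays for.\<close>

lemma subgaussian_pairwise_tail: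
  fixes \<epsilon> :: "'a \<Rightarrow> real ^ 'n::finite" and f :: "'l \<Rightarrow> real ^ 'n"
  assumes indep: "indep_vars (\<lambda>_. borel) (\<lambda>i \<omega>. \<epsilon> \<omega> $ i) UNIV"
    and sub: "\<And>i. subgaussian M (\<lambda>\<omega>. \<epsilon> \<omega> $ i) \<sigma>"
    and L: "finite L" "L \<noteq> {}" and "0 \<le> x"
  shows "prob {\<omega> \<in> space M. \<exists>l\<in>L. \<exists>l'\<in>L.
      \<sigma> * (2 * sqrt (ln (card L)) + x) * norm (f l - f l') < \<epsilon> \<omega> \<bullet> (f l - f l')}
    \<le> exp (- (x\<^sup>2 / 2))"
proof -
  define s where "s = 2 * sqrt (ln (card L)) + x"
  define E where "E = (\<lambda>(l, l'). {\<omega> \<in> space M. \<sigma> * s * norm (f l - f l') < \<epsilon> \<omega> \<bullet> (f l - f l')})"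
  have card: "1 \<le> card L" using L by (simp add: Suc_le_eq card_gt_0_iff)
  then have ln: "0 \<le> ln (real (card L))" by simp
  have s: "0 \<le> s" using ln \<open>0 \<le> x\<close> by (simp add: s_def)
  have [measurable]: "(\<lambda>\<omega>. \<epsilon> \<omega> $ i) \<in> borel_measurable M" for i
    using indep unfolding indep_vars_def by auto
  have E: "E p \<in> events" for p
    unfolding E_def inner_vec_def by (cases p) simp
  have "prob (\<Union>p\<in>L \<times> L. E p) \<le> (\<Sum>p\<in>L \<times> L. prob (E p))"
    using E L by (intro finite_measure_subadditive_finite) auto
  also have "\<dots> \<le> (\<Sum>p\<in>L \<times> L. exp (- (s\<^sup>2 / 2)))"
    unfolding E_def
    by (intro sum_mono) (auto simp: split_beta intro: subgaussian_inner_tail[OF indep sub s])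
  also have "\<dots> = (real (card L))\<^sup>2 * exp (- (s\<^sup>2 / 2))"
    by (simp add: card_cartesian_product power2_eq_square)
  also have "\<dots> \<le> (real (card L))\<^sup>2 * exp (- (2 * ln (card L)) + - (x\<^sup>2 / 2))"
  proof -
    \<comment> \<open>The cross term of the square is nonnegative. Hence
      \<open>exp (- (s\<^sup>2 / 2))\<close> is at most \<open>exp (- (x\<^sup>2 / 2))\<close>
      divided by the number of pairs.\<close>
    have "4 * ln (card L) + x\<^sup>2 \<le> s\<^sup>2"
      using ln \<open>0 \<le> x\<close> by (simp add: s_def power2_sum power_mult_distrib)
    then show ?thesis by (intro mult_left_mono) auto
  qed
  also have "\<dots> = exp (- (x\<^sup>2 / 2))"
    using card unfolding exp_add exp_minus
    by (simp add: exp_double[of "ln (real (card L))"])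
  finally have "prob (\<Union>p\<in>L \<times> L. E p) \<le> exp (- (x\<^sup>2 / 2))" .
  also have "(\<Union>p\<in>L \<times> L. E p) = {\<omega> \<in> space M. \<exists>l\<in>L. \<exists>l'\<in>L.
      \<sigma> * s * norm (f l - f l') < \<epsilon> \<omega> \<bullet> (f l - f l')}"
    unfolding E_def by auto
  finally show ?thesis unfolding s_def .
qed

section \<open>Separating the noise on a fold from the noise off it\<close>

lemma indep_var_restr:
  fixes \<epsilon> :: "'a \<Rightarrow> real ^ 'n::finite"
  assumes indep: "indep_vars (\<lambda>_. borel) (\<lambda>i \<omega>. \<epsilon> \<omega> $ i) UNIV"
    and "S \<inter> T = {}"
  shows "indep_var borel (\<lambda>\<omega>. restr S (\<epsilon> \<omega>)) borel (\<lambda>\<omega>. restr T (\<epsilon> \<omega>))"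
proof -
  \<comment> \<open>Independence of blocks of coordinates is available for functions on
    \<open>S\<close>; \<open>r\<close> pads such a function by zeros to a vector, and being
    measurable it preserves independence.\<close>
  define r :: "'n set \<Rightarrow> ('n \<Rightarrow> real) \<Rightarrow> real ^ 'n"
    where "r S f = (\<chi> i. if i \<in> S then f i else 0)" for S f
  have r: "r S \<in> measurable (PiM S (\<lambda>_. borel)) borel" for S
    unfolding r_def
  proof (subst borel_measurable_euclidean_space, intro ballI)
    fix b :: "real ^ 'n" assume "b \<in> Basis"
    then obtain i where b: "b = axis i 1" by (auto simp: Basis_vec_def)
    show "(\<lambda>f. (\<chi> i. if i \<in> S then f i else 0) \<bullet> b) \<in> borel_measurable (PiM S (\<lambda>_. borel))"
      unfolding b by (cases "i \<in> S") (simp_all add: inner_axis)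
  qed
  have r_eq: "r S \<circ> (\<lambda>\<omega>. restrict (\<lambda>i. \<epsilon> \<omega> $ i) S) = (\<lambda>\<omega>. restr S (\<epsilon> \<omega>))" for S
    by (auto simp: r_def vec_eq_iff fun_eq_iff)
  have "indep_var (PiM S (\<lambda>_. borel)) (\<lambda>\<omega>. restrict (\<lambda>i. \<epsilon> \<omega> $ i) S)
      (PiM T (\<lambda>_. borel)) (\<lambda>\<omega>. restrict (\<lambda>i. \<epsilon> \<omega> $ i) T)"
    by (rule indep_var_restrict[OF indep]) (use assms in auto)
  from indep_var_compose[OF this r r] show ?thesis unfolding r_eq .
qed

text \<open>Fubini for the independent pair of off-fold and on-fold noise: once the former is fixed,
  the candidates are deterministic and the pairwise tail bound applies. The exceptional set is a
  Borel set of noise values, so that its preimage is independent of random folds.\<close>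

lemma fold_bad_event:
  fixes \<epsilon> :: "'a \<Rightarrow> real ^ 'n::finite" and L :: "real ^ 'n \<Rightarrow> real set"
    and g :: "real \<Rightarrow> real ^ 'n \<Rightarrow> real ^ 'n"
  assumes indep: "indep_vars (\<lambda>_. borel) (\<lambda>i \<omega>. \<epsilon> \<omega> $ i) UNIV"
    and sub: "\<And>i. subgaussian M (\<lambda>\<omega>. \<epsilon> \<omega> $ i) \<sigma>"
    and L_dep: "depends_only_on (- S) L"
    and L: "\<And>y. finite (L y)" "\<And>y. L y \<noteq> {}" "\<And>y. L y \<subseteq> P"
    and effros: "\<And>B. open B \<Longrightarrow> {y. L y \<inter> B \<noteq> {}} \<in> sets borel"
    and g_meas: "(\<lambda>(l, y). g l y) \<in> borel_measurable (restrict_space borel {(l, y). l \<in> L y})"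
    and g_dep: "\<And>l. l \<in> P \<Longrightarrow> depends_only_on (- S) (g l)"
    and "0 \<le> x"
  shows "\<exists>E\<in>sets borel. prob {\<omega> \<in> space M. \<epsilon> \<omega> \<in> E} \<le> exp (- (x\<^sup>2 / 2)) \<and>
    (\<forall>e. e \<notin> E \<longrightarrow> (\<forall>l\<in>L (\<theta> + e). \<forall>l'\<in>L (\<theta> + e).
      e \<bullet> restr S (g l (\<theta> + e) - g l' (\<theta> + e)) \<le>
        \<sigma> * (2 * sqrt (ln (card (L (\<theta> + e)))) + x) * norm (restr S (g l (\<theta> + e) - g l' (\<theta> + e)))))"
proof -
  obtain h :: "rat \<Rightarrow> real ^ 'n \<Rightarrow> real"
    where h [measurable]: "\<And>q. h q \<in> borel_measurable borel"
      and L_h: "\<And>y. L y = range (\<lambda>q. h q y)"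
    using measurable_enumeration[of borel L] L effros by auto
  have [measurable]: "(\<lambda>y. g (h q y) y) \<in> borel_measurable borel" for q
  proof -
    \<comment> \<open>The pair stays on the graph of \<open>L\<close>, the only place where
      \<open>g\<close> is assumed jointly measurable.\<close>
    have "(\<lambda>y. (h q y, y)) \<in> measurable borel (restrict_space borel {(l, y). l \<in> L y})"
      by (rule measurable_restrict_space2) (auto simp: L_h borel_prod[symmetric])
    from measurable_compose[OF this g_meas] show ?thesis by simp
  qed
  have [measurable]: "(\<lambda>y. card (L y)) \<in> measurable borel (count_space UNIV)"
    unfolding L_h by (rule card_range_measurable) (use L L_h in auto)
  let ?t = "\<lambda>y. \<sigma> * (2 * sqrt (ln (real (card (L y)))) + x)"
  let ?d = "\<lambda>y l l'. restr S (g l y - g l' y)"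
  \<comment> \<open>The data \<open>y\<close> that determine the candidates and the noise
    \<open>u\<close> tested against them are separate arguments, so that one can be fixed while the
    other varies.\<close>
  define bad where "bad y u \<longleftrightarrow> (\<exists>l\<in>L y. \<exists>l'\<in>L y. ?t y * norm (?d y l l') < u \<bullet> ?d y l l')" for y u
  define B where "B = {p :: (real ^ 'n) \<times> (real ^ 'n). bad (\<theta> + fst p) (snd p)}"
  define split where "split e = (restr (- S) e, restr S e)" for e :: "real ^ 'n"
  \<comment> \<open>Indexing candidates by rationals makes the quantifiers countable, hence
    \<open>bad\<close> jointly measurable.\<close>
  have bad_h: "bad y u \<longleftrightarrow> (\<exists>q q'. ?t y * norm (?d y (h q y) (h q' y)) < u \<bullet> ?d y (h q y) (h q' y))" for y u
    unfolding bad_def L_h by blast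
  have B [measurable]: "B \<in> sets (borel \<Otimes>\<^sub>M borel)"
  proof -
    have "{p \<in> space (borel \<Otimes>\<^sub>M borel). bad (\<theta> + fst p) (snd p)} \<in> sets (borel \<Otimes>\<^sub>M borel)"
      unfolding bad_h by measurable
    then show ?thesis by (simp add: B_def space_pair_measure)
  qed
  have split [measurable]: "split \<in> measurable borel (borel \<Otimes>\<^sub>M borel)"
    unfolding split_def by measurable
  have \<epsilon> [measurable]: "\<epsilon> \<in> borel_measurable M"
  proof (subst borel_measurable_euclidean_space, intro ballI)
    fix b :: "real ^ 'n" assume "b \<in> Basis"
    then obtain i where "b = axis i 1" by (auto simp: Basis_vec_def)
    then show "(\<lambda>\<omega>. \<epsilon> \<omega> \<bullet> b) \<in> borel_measurable M"
      using indep unfolding indep_vars_def by (auto simp: inner_axis)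
  qed
  let ?V = "distr M borel (\<lambda>\<omega>. restr (- S) (\<epsilon> \<omega>))" and ?U = "distr M borel (\<lambda>\<omega>. restr S (\<epsilon> \<omega>))"
  interpret U: prob_space ?U by (rule prob_space_distr) measurable
  interpret V: prob_space ?V by (rule prob_space_distr) measurable
  \<comment> \<open>Independence says that the joint law of the two parts of the noise is the
    product of their laws.\<close>
  have VU: "?V \<Otimes>\<^sub>M ?U = distr M (borel \<Otimes>\<^sub>M borel) (\<lambda>\<omega>. split (\<epsilon> \<omega>))"
    using indep_var_restr[OF indep, of "- S" S] unfolding indep_var_distribution_eq split_def by simp
  have "emeasure M {\<omega> \<in> space M. split (\<epsilon> \<omega>) \<in> B} = emeasure (?V \<Otimes>\<^sub>M ?U) B"
    unfolding VU by (subst emeasure_distr) (auto intro!: arg_cong[where f="emeasure M"])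
  also have "\<dots> = (\<integral>\<^sup>+ v. emeasure ?U (Pair v -` B) \<partial>?V)"
    by (rule U.emeasure_pair_measure_alt) (simp cong: sets_pair_measure_cong)
  also have "\<dots> \<le> (\<integral>\<^sup>+ v. ennreal (exp (- (x\<^sup>2 / 2))) \<partial>?V)"
  proof (rule nn_integral_mono)
    fix v
    have "Pair v -` B \<in> sets borel" by (rule sets_Pair1[OF B])
    then have "emeasure ?U (Pair v -` B) = emeasure M {\<omega> \<in> space M. bad (\<theta> + v) (restr S (\<epsilon> \<omega>))}"
      by (subst emeasure_distr) (auto simp: B_def intro!: arg_cong[where f="emeasure M"])
    also have "\<dots> \<le> ennreal (exp (- (x\<^sup>2 / 2)))"
      unfolding emeasure_eq_measure bad_def
      \<comment> \<open>The vectors compared are already restricted to \<open>S\<close>, so pairing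
        them with \<open>restr S (\<epsilon> \<omega>)\<close> or with the full noise gives the same
        number.\<close>
      using subgaussian_pairwise_tail[OF indep sub L(1,2) \<open>0 \<le> x\<close>,
          of "\<theta> + v" "\<lambda>l. restr S (g l (\<theta> + v))"]
      by (simp add: inner_restr_left restr_restr restr_diff ennreal_leI)
    finally show "emeasure ?U (Pair v -` B) \<le> ennreal (exp (- (x\<^sup>2 / 2)))" .
  qed
  also have "\<dots> = ennreal (exp (- (x\<^sup>2 / 2)))"
    using V.emeasure_space_1 by simp
  finally have prob: "prob {\<omega> \<in> space M. split (\<epsilon> \<omega>) \<in> B} \<le> exp (- (x\<^sup>2 / 2))"
    by (simp add: emeasure_eq_measure)
  show ?thesis
  proof (intro bexI[of _ "split -` B"] conjI allI impI ballI)
    show "split -` B \<in> sets borel"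
      using measurable_sets[OF split B] by simp
    show "prob {\<omega> \<in> space M. \<epsilon> \<omega> \<in> split -` B} \<le> exp (- (x\<^sup>2 / 2))"
      using prob by simp
  next
    fix e l l'
    assume e: "e \<notin> split -` B" and l: "l \<in> L (\<theta> + e)" "l' \<in> L (\<theta> + e)"
    \<comment> \<open>Back from the off-fold noise to the full data: neither the candidates nor
      their estimators see the noise on \<open>S\<close>.\<close>
    have [simp]: "L (\<theta> + restr (- S) e) = L (\<theta> + e)"
      by (rule depends_only_on_restr[OF L_dep])
    have [simp]: "g k (\<theta> + restr (- S) e) = g k (\<theta> + e)" if "k \<in> L (\<theta> + e)" for k
      using that L(3) by (intro depends_only_on_restr g_dep) auto
    have "\<not> bad (\<theta> + restr (- S) e) (restr S e)"
      using e by (simp add: B_def split_def)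
    then show "e \<bullet> ?d (\<theta> + e) l l' \<le> ?t (\<theta> + e) * norm (?d (\<theta> + e) l l')"
      using l by (auto simp: bad_def inner_restr_left restr_restr not_less)
  qed
qed

end

section \<open>Deterministic comparison of selected and best candidate\<close>

text \<open>Expanding the squared residuals bounds
  \<open>(norm a)\<^sup>2 - (norm b)\<^sup>2\<close> by \<open>2 * t * norm (a - b)\<close>, hence
  by \<open>2 * t * (norm a + norm b)\<close>. The common factor \<open>norm a + norm b\<close>
  cancels; it is positive when the claim fails.\<close>

lemma holdout_selection_bound:
  fixes a b e :: "'v::real_inner"
  assumes sel: "norm (e - a) \<le> norm (e - b)"
    and noise: "e \<bullet> (a - b) \<le> t * norm (a - b)"
    and "0 \<le> t"
  shows "norm a \<le> norm b + 2 * t"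
proof (rule ccontr)
  assume "\<not> norm a \<le> norm b + 2 * t"
  then have gt: "2 * t < norm a - norm b" by simp
  have "(norm (e - a))\<^sup>2 \<le> (norm (e - b))\<^sup>2" using sel by (simp add: power_mono)
  then have "(norm a)\<^sup>2 - (norm b)\<^sup>2 \<le> 2 * (e \<bullet> (a - b))"
    by (simp add: power2_norm_eq_inner inner_diff_left inner_diff_right inner_commute)
  also have "\<dots> \<le> 2 * (t * (norm a + norm b))"
    using noise mult_left_mono[OF norm_triangle_ineq4 \<open>0 \<le> t\<close>, of a b] by linarith
  finally have "(norm a - norm b) * (norm a + norm b) \<le> (2 * t) * (norm a + norm b)"
    by (simp add: power2_eq_square algebra_simps)
  moreover have "0 < norm a + norm b"
    using gt \<open>0 \<le> t\<close> norm_ge_zero[of b] by linarith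
  ultimately show False using gt by (simp add: mult_le_cancel_right)
qed

section \<open>Assembly of the oracle inequality from the fold-wise events\<close>

theorem mainTheorem1:
  fixes M :: "'w measure"
    and \<epsilon> :: "'w \<Rightarrow> real ^ 'n::finite"
    and \<theta>s :: "real ^ 'n"
    and y :: "'w \<Rightarrow> real ^ 'n"
    and \<sigma> x :: real
    and I :: "'w \<Rightarrow> 'k::finite \<Rightarrow> 'n set"
    and \<theta>h :: "real \<Rightarrow> real ^ 'n \<Rightarrow> real ^ 'n"
    and \<theta>c :: "('k \<Rightarrow> 'n set) \<Rightarrow> 'k \<Rightarrow> real \<Rightarrow> real ^ 'n \<Rightarrow> real ^ 'n"
    and \<Lambda>f :: "('k \<Rightarrow> 'n set) \<Rightarrow> 'k \<Rightarrow> real ^ 'n \<Rightarrow> real set"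
    and \<Lambda> :: "real set"
    and lf :: "('k \<Rightarrow> 'n set) \<Rightarrow> 'k \<Rightarrow> real ^ 'n \<Rightarrow> real"
    and lh :: "('k \<Rightarrow> 'n set) \<Rightarrow> real ^ 'n \<Rightarrow> real"
  assumes "prob_space M"
    and y: "\<And>\<omega>. y \<omega> = \<theta>s + \<epsilon> \<omega>"
    and eps_indep: "prob_space.indep_vars M (\<lambda>_. borel) (\<lambda>i \<omega>. \<epsilon> \<omega> $ i) UNIV"
    and eps_ident: "\<And>i i'. distr M borel (\<lambda>\<omega>. \<epsilon> \<omega> $ i) = distr M borel (\<lambda>\<omega>. \<epsilon> \<omega> $ i')"
    and eps_subgaussian: "\<And>i. subgaussian M (\<lambda>\<omega>. \<epsilon> \<omega> $ i) \<sigma>"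
    and "2 \<le> CARD('k)"
    and folds: "\<And>\<omega>. \<omega> \<in> space M \<Longrightarrow> fold_partition (I \<omega>)"
    and folds_measurable: "I \<in> measurable M (count_space UNIV)"
    and folds_indep: "prob_space.indep_set M
          (sets (vimage_algebra (space M) I (count_space UNIV)))
          (sets (vimage_algebra (space M) \<epsilon> borel))"
    and estimators: "\<And>l. 0 \<le> l \<Longrightarrow> \<theta>h l \<in> borel_measurable borel"
    and "completion_estimators \<theta>c"
    and "candidate_sets \<theta>c \<Lambda>f"
    and "fold_selection \<theta>c \<Lambda>f lf"
    and "\<And>J. fold_partition J \<Longrightarrow> intermediate_estimator \<theta>c lf J \<in> borel_measurable borel"
    and "\<Lambda> \<subseteq> {0..}"
    and min_attained: "\<And>z. \<exists>l. is_arg_min (\<lambda>l. norm (\<theta>h l z - \<theta>s)) (\<lambda>l. l \<in> \<Lambda>) l"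
    and "final_selection \<theta>h \<Lambda> (intermediate_estimator \<theta>c lf) lh"
    and "\<And>J. fold_partition J \<Longrightarrow> cv_estimator \<theta>h lh J \<in> borel_measurable borel"
    and "0 \<le> x"
  shows "\<exists>A \<in> sets M. 1 - 2 * real CARD('k) * exp (- (x\<^sup>2 / 2)) \<le> measure M A \<and>
    (\<forall>\<omega>\<in>A.
       norm (cv_estimator \<theta>h lh (I \<omega>) (y \<omega>) - \<theta>s)
       \<le> (INF l\<in>\<Lambda>. norm (\<theta>h l (y \<omega>) - \<theta>s))
         + 4 * (\<Sum>j\<in>UNIV. Min ((\<lambda>l. norm (restr (I \<omega> j) (\<theta>c (I \<omega>) j l (y \<omega>)) - restr (I \<omega> j) \<theta>s))
                 ` \<Lambda>f (I \<omega>) j (y \<omega>)))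
         + 8 * sqrt 2 * \<sigma> * (\<Sum>j\<in>UNIV. sqrt (ln (real (card (\<Lambda>f (I \<omega>) j (y \<omega>))))))
         + 8 * \<sigma> * real CARD('k) * x)"
proof -
  interpret prob_space M by fact
  let ?p = "exp (- (x\<^sup>2 / 2))"
  let ?y = "\<lambda>e. \<theta>s + e"
  define t where "t J j z = \<sigma> * (2 * sqrt (ln (real (card (\<Lambda>f J j z)))) + x)" for J :: "'k \<Rightarrow> 'n set" and j z
  have \<sigma>: "0 \<le> \<sigma>" using eps_subgaussian unfolding subgaussian_def by blast
  have cand: "depends_only_on (- J j) (\<Lambda>f J j)" "finite (\<Lambda>f J j z)" "\<Lambda>f J j z \<noteq> {}"
      "\<Lambda>f J j z \<subseteq> {0<..}" "\<And>B. open B \<Longrightarrow> {z. \<Lambda>f J j z \<inter> B \<noteq> {}} \<in> sets borel"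
      "(\<lambda>(l, z). \<theta>c J j l z) \<in> borel_measurable (restrict_space borel {(l, z). l \<in> \<Lambda>f J j z})"
    if "fold_partition J" for J j z
    using \<open>candidate_sets \<theta>c \<Lambda>f\<close> that unfolding candidate_sets_def by auto
  \<comment> \<open>Naming the property of an exceptional set allows one such set to be chosen for
    every partition and fold simultaneously.\<close>
  define controls where "controls J j E \<longleftrightarrow>
      E \<in> sets borel \<and> prob {\<omega> \<in> space M. \<epsilon> \<omega> \<in> E} \<le> ?p \<and>
      (\<forall>e. e \<notin> E \<longrightarrow> (\<forall>l\<in>\<Lambda>f J j (?y e). \<forall>l'\<in>\<Lambda>f J j (?y e).
        e \<bullet> restr (J j) (\<theta>c J j l (?y e) - \<theta>c J j l' (?y e)) \<le>
          t J j (?y e) * norm (restr (J j) (\<theta>c J j l (?y e) - \<theta>c J j l' (?y e)))))" for J j E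
  have "\<exists>E. controls J j E" if J: "fold_partition J" for J j
  proof -
    have "depends_only_on (- J j) (\<theta>c J j l)" if "l \<in> {0<..}" for l
      using \<open>completion_estimators \<theta>c\<close> J that unfolding completion_estimators_def by auto
    from fold_bad_event[OF eps_indep eps_subgaussian cand[OF J] this \<open>0 \<le> x\<close>]
    show ?thesis unfolding controls_def t_def by blast
  qed
  then obtain E where "\<And>J j. fold_partition J \<Longrightarrow> controls J j (E J j)"
    by metis
  then have E: "E J j \<in> sets borel" "prob {\<omega> \<in> space M. \<epsilon> \<omega> \<in> E J j} \<le> ?p"
      "\<And>e l l'. \<lbrakk>e \<notin> E J j; l \<in> \<Lambda>f J j (?y e); l' \<in> \<Lambda>f J j (?y e)\<rbrakk> \<Longrightarrow>
        e \<bullet> restr (J j) (\<theta>c J j l (?y e) - \<theta>c J j l' (?y e)) \<le>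
          t J j (?y e) * norm (restr (J j) (\<theta>c J j l (?y e) - \<theta>c J j l' (?y e)))"
    if "fold_partition J" for J j
    using that unfolding controls_def by auto

  \<comment> \<open>Union bound over partitions and folds\<close>
  let ?P = "{J :: 'k \<Rightarrow> 'n set. fold_partition J}"
  define FI where "FI J = {\<omega> \<in> space M. I \<omega> = J}" for J
  define FE where "FE J j = {\<omega> \<in> space M. \<epsilon> \<omega> \<in> E J j}" for J j
  have FI_sets: "FI J \<in> sets (vimage_algebra (space M) I (count_space UNIV))" for J
    using in_vimage_algebra[of "{J}" "count_space UNIV" I "space M"]
    by (simp add: FI_def vimage_def Int_def conj_commute)
  have FE_sets: "FE J j \<in> sets (vimage_algebra (space M) \<epsilon> borel)" if "fold_partition J" for J j
    using in_vimage_algebra[OF E(1)[OF that, of j], of \<epsilon> "space M"]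
    by (simp add: FE_def vimage_def Int_def conj_commute)
  have FI_ev: "FI J \<in> events" for J
    using indep_setD_ev1[OF folds_indep] FI_sets by blast
  have FE_ev: "FE J j \<in> events" if "fold_partition J" for J j
    using indep_setD_ev2[OF folds_indep] FE_sets[OF that] by blast
  \<comment> \<open>Only the exceptional sets belonging to the realised partition count, hence the
    intersection with \<open>FI J\<close>.\<close>
  define bad where "bad = (\<Union>J\<in>?P. \<Union>j. FI J \<inter> FE J j)"
  have bad_ev: "bad \<in> events"
    unfolding bad_def using FI_ev FE_ev by (intro sets.finite_UN) auto
  have "prob bad \<le> (\<Sum>J\<in>?P. prob (\<Union>j. FI J \<inter> FE J j))"
    unfolding bad_def using FI_ev FE_ev
    by (intro finite_measure_subadditive_finite) (auto intro!: sets.finite_UN)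
  also have "\<dots> \<le> (\<Sum>J\<in>?P. \<Sum>j\<in>UNIV. prob (FI J \<inter> FE J j))"
    using FI_ev FE_ev by (intro sum_mono finite_measure_subadditive_finite) auto
  \<comment> \<open>\<open>FI J\<close> is determined by the folds and \<open>FE J j\<close> by the
    noise, so independence factors the probability of their intersection.\<close>
  also have "\<dots> \<le> (\<Sum>J\<in>?P. \<Sum>j\<in>(UNIV :: 'k set). prob (FI J) * ?p)"
    using E(2) indep_setD[OF folds_indep FI_sets FE_sets]
    by (intro sum_mono) (auto simp: FE_def intro!: mult_left_mono)
  also have "\<dots> = real CARD('k) * ?p * (\<Sum>J\<in>?P. prob (FI J))"
    by (simp add: sum_distrib_left sum_distrib_right mult_ac)
  \<comment> \<open>The events \<open>FI J\<close> are disjoint, so the number of partitions does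
    not enter the bound.\<close>
  also have "(\<Sum>J\<in>?P. prob (FI J)) = prob (\<Union>J\<in>?P. FI J)"
    using FI_ev by (intro finite_measure_finite_Union[symmetric])
      (auto simp: disjoint_family_on_def FI_def)
  also have "real CARD('k) * ?p * \<dots> \<le> real CARD('k) * ?p * 1"
    by (intro mult_left_mono) auto
  also have "\<dots> \<le> 2 * real CARD('k) * ?p" by simp
  finally have prob_bad: "prob bad \<le> 2 * real CARD('k) * ?p" .

  show ?thesis
  proof (intro bexI[of _ "space M - bad"] conjI ballI)
    show "space M - bad \<in> events" using bad_ev by auto
    show "1 - 2 * real CARD('k) * ?p \<le> prob (space M - bad)"
      using prob_bad by (simp add: prob_compl[OF bad_ev])
  next

    \<comment> \<open>Risk bound at a sample point outside the exceptional event\<close>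
    fix \<omega> assume \<omega>: "\<omega> \<in> space M - bad"
    define J where "J = I \<omega>"
    define z where "z = y \<omega>"
    define \<theta>t where "\<theta>t = intermediate_estimator \<theta>c lf J z"
    let ?r = "\<lambda>j l. norm (restr (J j) (\<theta>c J j l z) - restr (J j) \<theta>s)"
    have J: "fold_partition J" using \<omega> folds by (simp add: J_def)
    have z: "z = ?y (\<epsilon> \<omega>)" by (simp add: z_def y)
    have good: "\<epsilon> \<omega> \<notin> E J j" for j
      using \<omega> J unfolding bad_def FI_def FE_def J_def by auto
    have t: "0 \<le> t J j z" for j
    proof -
      have "0 < card (\<Lambda>f J j z)" using cand[OF J] by (simp add: card_gt_0_iff)
      then show ?thesis using \<sigma> \<open>0 \<le> x\<close> unfolding t_def
        by (intro mult_nonneg_nonneg add_nonneg_nonneg) auto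
    qed
    have fold: "norm (restr (J j) (\<theta>t - \<theta>s)) \<le> Min (?r j ` \<Lambda>f J j z) + 2 * t J j z" for j
    proof -
      let ?l = "lf J j z"
      have sel: "is_arg_min (\<lambda>l. (norm (restr (J j) z - restr (J j) (\<theta>c J j l z)))\<^sup>2)
          (\<lambda>l. l \<in> \<Lambda>f J j z) ?l"
        using \<open>fold_selection \<theta>c \<Lambda>f lf\<close> J unfolding fold_selection_def by blast
      then have l: "?l \<in> \<Lambda>f J j z" by (simp add: is_arg_min_def)
      have \<theta>t: "restr (J j) (\<theta>t - \<theta>s) = restr (J j) (\<theta>c J j ?l z - \<theta>s)"
        by (auto simp: vec_eq_iff \<theta>t_def intermediate_estimator_def fold_of_eq[OF J])
      have "Min (?r j ` \<Lambda>f J j z) \<in> ?r j ` \<Lambda>f J j z"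
        using cand[OF J] by (intro Min_in) auto
      \<comment> \<open>The best candidate \<open>k\<close> depends on the noise on the fold; the
        bound for all pairs of candidates still covers it.\<close>
      then obtain k where k: "k \<in> \<Lambda>f J j z" "Min (?r j ` \<Lambda>f J j z) = ?r j k" by blast
      \<comment> \<open>The hold-out residual is the noise minus the estimation error, the form
        \<open>e - a\<close> of the comparison lemma.\<close>
      have resid: "restr (J j) (\<epsilon> \<omega>) - restr (J j) (\<theta>c J j m z - \<theta>s) =
          restr (J j) z - restr (J j) (\<theta>c J j m z)" for m
        by (simp add: z restr_add restr_diff)
      have "norm (restr (J j) (\<theta>c J j ?l z - \<theta>s)) \<le> norm (restr (J j) (\<theta>c J j k z - \<theta>s)) + 2 * t J j z"
      proof (rule holdout_selection_bound)
        have "(norm (restr (J j) z - restr (J j) (\<theta>c J j ?l z)))\<^sup>2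
            \<le> (norm (restr (J j) z - restr (J j) (\<theta>c J j k z)))\<^sup>2"
          using sel k(1) by (auto simp: is_arg_min_linorder)
        then show "norm (restr (J j) (\<epsilon> \<omega>) - restr (J j) (\<theta>c J j ?l z - \<theta>s))
            \<le> norm (restr (J j) (\<epsilon> \<omega>) - restr (J j) (\<theta>c J j k z - \<theta>s))"
          unfolding resid by (rule power2_le_imp_le) simp
        have "restr (J j) (\<theta>c J j ?l z - \<theta>s) - restr (J j) (\<theta>c J j k z - \<theta>s) =
            restr (J j) (\<theta>c J j ?l z - \<theta>c J j k z)"
          by (simp add: restr_diff)
        then show "restr (J j) (\<epsilon> \<omega>) \<bullet> (restr (J j) (\<theta>c J j ?l z - \<theta>s) - restr (J j) (\<theta>c J j k z - \<theta>s))
            \<le> t J j z * norm (restr (J j) (\<theta>c J j ?l z - \<theta>s) - restr (J j) (\<theta>c J j k z - \<theta>s))"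
          using E(3)[OF J good[of j], of ?l k] l k(1) by (simp add: z inner_restr_left restr_restr)
      qed (fact t)
      then show ?thesis unfolding \<theta>t k(2) by (simp add: restr_diff)
    qed
    let ?R = "4 * (\<Sum>j\<in>UNIV. Min (?r j ` \<Lambda>f J j z))
         + 8 * sqrt 2 * \<sigma> * (\<Sum>j\<in>UNIV. sqrt (ln (real (card (\<Lambda>f J j z)))))
         + 8 * \<sigma> * real CARD('k) * x"
    have "2 * norm (\<theta>t - \<theta>s) \<le> 2 * (\<Sum>j\<in>UNIV. norm (restr (J j) (\<theta>t - \<theta>s)))"
      using norm_le_sum_folds[OF J, of "\<theta>t - \<theta>s"] by simp
    also have "\<dots> \<le> 2 * (\<Sum>j\<in>UNIV. Min (?r j ` \<Lambda>f J j z) + 2 * t J j z)"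
      by (intro mult_left_mono sum_mono fold) simp
    also have "\<dots> = (\<Sum>j\<in>UNIV. 2 * Min (?r j ` \<Lambda>f J j z)
        + 8 * \<sigma> * sqrt (ln (real (card (\<Lambda>f J j z)))) + 4 * \<sigma> * x)"
      unfolding sum_distrib_left by (intro sum.cong) (auto simp: t_def algebra_simps)
    \<comment> \<open>All three terms are nonnegative, so the constants 2, 8 and 4 may be enlarged
      to the stated 4, \<open>8 * sqrt 2\<close> and 8.\<close>
    also have "\<dots> \<le> (\<Sum>j\<in>UNIV. 4 * Min (?r j ` \<Lambda>f J j z)
        + 8 * sqrt 2 * \<sigma> * sqrt (ln (real (card (\<Lambda>f J j z)))) + 8 * \<sigma> * x)"
    proof (intro sum_mono add_mono)
      fix j
      have "0 \<le> Min (?r j ` \<Lambda>f J j z)" using cand[OF J] by (subst Min_ge_iff) auto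
      then show "2 * Min (?r j ` \<Lambda>f J j z) \<le> 4 * Min (?r j ` \<Lambda>f J j z)" by simp
      have "0 < card (\<Lambda>f J j z)" using cand[OF J] by (simp add: card_gt_0_iff)
      then have "0 \<le> \<sigma> * sqrt (ln (real (card (\<Lambda>f J j z))))"
        using \<sigma> by (intro mult_nonneg_nonneg) auto
      from mult_right_mono[OF _ this, of 8 "8 * sqrt 2"]
      show "8 * \<sigma> * sqrt (ln (real (card (\<Lambda>f J j z))))
          \<le> 8 * sqrt 2 * \<sigma> * sqrt (ln (real (card (\<Lambda>f J j z))))"
        by (simp add: mult_ac)
      show "4 * \<sigma> * x \<le> 8 * \<sigma> * x" using \<sigma> \<open>0 \<le> x\<close> by (intro mult_right_mono) auto
    qed
    also have "\<dots> = ?R" by (simp add: sum.distrib sum_distrib_left mult_ac)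
    finally have \<theta>t: "2 * norm (\<theta>t - \<theta>s) \<le> ?R" .
    have fin: "is_arg_min (\<lambda>l. (norm (\<theta>h l z - \<theta>t))\<^sup>2) (\<lambda>l. l \<in> \<Lambda>) (lh J z)"
      using \<open>final_selection \<theta>h \<Lambda> _ lh\<close> J unfolding final_selection_def \<theta>t_def by blast
    \<comment> \<open>With \<open>?R\<close>, which is free of \<open>l\<close>, on the left, this
      is a lower bound for all errors over \<open>\<Lambda>\<close> and so passes to their
      infimum.\<close>
    have "norm (cv_estimator \<theta>h lh J z - \<theta>s) - ?R \<le> norm (\<theta>h l z - \<theta>s)" if "l \<in> \<Lambda>" for l
    proof -
      have "(norm (\<theta>h (lh J z) z - \<theta>t))\<^sup>2 \<le> (norm (\<theta>h l z - \<theta>t))\<^sup>2"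
        using fin that by (auto simp: is_arg_min_linorder)
      then have "norm (\<theta>h (lh J z) z - \<theta>t) \<le> norm (\<theta>h l z - \<theta>t)"
        by (rule power2_le_imp_le) simp
      moreover have "norm (\<theta>h (lh J z) z - \<theta>s) \<le> norm (\<theta>h (lh J z) z - \<theta>t) + norm (\<theta>t - \<theta>s)"
        using norm_triangle_ineq[of "\<theta>h (lh J z) z - \<theta>t" "\<theta>t - \<theta>s"] by simp
      moreover have "norm (\<theta>h l z - \<theta>t) \<le> norm (\<theta>h l z - \<theta>s) + norm (\<theta>t - \<theta>s)"
        using norm_triangle_ineq4[of "\<theta>h l z - \<theta>s" "\<theta>t - \<theta>s"] by simp
      ultimately show ?thesis using \<theta>t unfolding cv_estimator_def by linarith
    qed
    moreover have "\<Lambda> \<noteq> {}" using fin by (auto simp: is_arg_min_def)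
    ultimately have "norm (cv_estimator \<theta>h lh J z - \<theta>s) - ?R \<le> (INF l\<in>\<Lambda>. norm (\<theta>h l z - \<theta>s))"
      by (intro cINF_greatest)
    then show "norm (cv_estimator \<theta>h lh (I \<omega>) (y \<omega>) - \<theta>s)
       \<le> (INF l\<in>\<Lambda>. norm (\<theta>h l (y \<omega>) - \<theta>s))
         + 4 * (\<Sum>j\<in>UNIV. Min ((\<lambda>l. norm (restr (I \<omega> j) (\<theta>c (I \<omega>) j l (y \<omega>)) - restr (I \<omega> j) \<theta>s))
                 ` \<Lambda>f (I \<omega>) j (y \<omega>)))
         + 8 * sqrt 2 * \<sigma> * (\<Sum>j\<in>UNIV. sqrt (ln (real (card (\<Lambda>f (I \<omega>) j (y \<omega>))))))
         + 8 * \<sigma> * real CARD('k) * x"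
      unfolding J_def z_def by linarith
  qed
qed

end
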